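(* For every s-tri-$\mathrm{Var}$-dendriform algebra $A$ over $\Bbbk$ there exist an algebra $\hat A\in\mathrm{Var}$ with a Rota--Baxter operator $R$ of weight zero and an injective linear map $\iota:A\to\hat A$ such that for all $a,b\in A$ and $i\in I$ $$\iota(a\vdash_i b)=R(\iota(a))\circ_i\iota(b),\quad \iota(a\dashv_i b)=\iota(a)\circ_i R(\iota(b)),\quad \iota(a\perp_i b)=\iota(a)\circ_i\iota(b).$$
   Context: $\Bbbk$ is an arbitrary field. $\Omega=\{\circ_i\mid i\in I\}$ is a set of binary operation symbols; an $\Omega$-algebra is a $\Bbbk$-linear space with bilinear operations $\circ_i$, $i\in I$. An $\Omega^{(3)}$-algebra is a $\Bbbk$-linear space with bilinear operations $\vdash_i,\dashv_i,\perp_i$, $i\in I$. $\mathrm{Var}$ is the variety of $\Omega$-algebras defined by a family $S$ of poly-linear identities of degrees greater than one: each $f\in S$ of degree $n$ is a $\Bbbk$-linear combination of non-associative $\Omega$-monomials in which each of $x_1,\dots,x_n$ occurs exactly once (in any order and with any bracketing). A Rota--Baxter operator of weight $\lambda\in\Bbbk$ on an $\Omega$-algebra $B$ is a linear map $R:B\to B$ with $R(x)\circ_i R(y)=R(x\circ_i R(y)+R(x)\circ_i y+\lambda\, x\circ_i y)$ for all $x,y\in B$, $i\in I$. For a poly-linear $\Omega$-monomial $v$, let $v^{\star}$ be the polynomial obtained by replacing each $\circ_j$ in $v$ with $\vdash_j+\dashv_j$ (and expanding). For a poly-linear $\Omega$-monomial $u$ and a nonempty set $H$ of indices of variables occurring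 in $u$, define $\Phi^{\star}(u^H)$ recursively: if $u$ is a single variable, $\Phi^{\star}(u^H)=u$; if $u=v\circ_i w$, let $H_1$ (resp. $H_2$) be the set of $k\in H$ such that $x_k$ occurs in $v$ (resp. $w$), and put $$\Phi^{\star}(u^H)=\begin{cases}\Phi^{\star}(v^{H_1})\perp_i\Phi^{\star}(w^{H_2}), & H_1,H_2\neq\emptyset,\\ v^{\star}\vdash_i\Phi^{\star}(w^{H}), & H_1=\emptyset,\\ \Phi^{\star}(v^{H})\dashv_i w^{\star}, & H_2=\emptyset.\end{cases}$$ Extend linearly to poly-linear $f$. An s-tri-$\mathrm{Var}$-dendriform ("skew") algebra is an $\Omega^{(3)}$-algebra satisfying $(x_1\perp_i x_2)\vdash_j x_3=0$ and $x_1\dashv_i(x_2\perp_j x_3)=0$ for all $i,j\in I$, together with $\Phi^{\star}(f^H)=0$ for all $f\in S$ and all nonempty $H\subseteq\{1,\dots,\deg f\}$. *)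

theory Defs
  imports Complex_Main "HOL-Library.Poly_Mapping" "HOL-Library.Product_Plus"
begin

section \<open>Algebras with a family of bilinear operations\<close>

locale omega_algebra = vector_space scale
  for scale :: "'k::field \<Rightarrow> 'a::ab_group_add \<Rightarrow> 'a" +
  fixes I :: "'i set" and mul :: "'i \<Rightarrow> 'a \<Rightarrow> 'a \<Rightarrow> 'a"
  assumes linear_left: "i \<in> I \<Longrightarrow> Vector_Spaces.linear scale scale (\<lambda>x. mul i x y)"
    and linear_right: "i \<in> I \<Longrightarrow> Vector_Spaces.linear scale scale (mul i x)"

section \<open>Non-associative polynomials\<close>

datatype 'i monom = Var nat | App 'i "'i monom" "'i monom"

fun var_list :: "'i monom \<Rightarrow> nat list" where
  "var_list (Var k) = [k]"
| "var_list (App i v w) = var_list v @ var_list w"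

abbreviation vars :: "'i monom \<Rightarrow> nat set" where
  "vars u \<equiv> set (var_list u)"

type_synonym ('i, 'k) npoly = "'i monom \<Rightarrow>\<^sub>0 'k"

definition cmul :: "'k::field \<Rightarrow> ('i, 'k) npoly \<Rightarrow> ('i, 'k) npoly" where
  "cmul c p = Poly_Mapping.map (\<lambda>d. c * d) p"

definition papp :: "'i \<Rightarrow> ('i, 'k::field) npoly \<Rightarrow> ('i, 'k) npoly \<Rightarrow> ('i, 'k) npoly" where
  "papp i p q = (\<Sum>v\<in>Poly_Mapping.keys p. \<Sum>w\<in>Poly_Mapping.keys q.
     Poly_Mapping.single (App i v w) (Poly_Mapping.lookup p v * Poly_Mapping.lookup q w))"

definition pdegree :: "('i, 'k::field) npoly \<Rightarrow> nat" where
  "pdegree f = Max (insert 0 ((\<lambda>u. length (var_list u)) ` Poly_Mapping.keys f))"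

text \<open>
  Poly-linearity of degree \<open>n\<close> over the symbols in \<open>I\<close>: each of the variables \<open>1, \<dots>, n\<close>
  occurs exactly once in every monomial. The zero polynomial qualifies for every \<open>n\<close>;
  for nonzero \<open>f\<close> the number \<open>n\<close> equals \<open>pdegree f\<close>.
\<close>

definition polylinear :: "'i set \<Rightarrow> nat \<Rightarrow> ('i, 'k::field) npoly \<Rightarrow> bool" where
  "polylinear I n f \<longleftrightarrow> (\<forall>u\<in>Poly_Mapping.keys f.
     set_monom u \<subseteq> I \<and> distinct (var_list u) \<and> vars u = {1..n})"

fun eval_monom :: "('i \<Rightarrow> 'a \<Rightarrow> 'a \<Rightarrow> 'a) \<Rightarrow> (nat \<Rightarrow> 'a) \<Rightarrow> 'i monom \<Rightarrow> 'a" where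
  "eval_monom mul x (Var k) = x k"
| "eval_monom mul x (App i v w) = mul i (eval_monom mul x v) (eval_monom mul x w)"

definition eval_poly ::
  "('k::field \<Rightarrow> 'a::ab_group_add \<Rightarrow> 'a) \<Rightarrow> ('i \<Rightarrow> 'a \<Rightarrow> 'a \<Rightarrow> 'a) \<Rightarrow> (nat \<Rightarrow> 'a) \<Rightarrow> ('i, 'k) npoly \<Rightarrow> 'a" where
  "eval_poly scale mul x f =
     (\<Sum>u\<in>Poly_Mapping.keys f. scale (Poly_Mapping.lookup f u) (eval_monom mul x u))"

definition satisfies ::
  "('k::field \<Rightarrow> 'a::ab_group_add \<Rightarrow> 'a) \<Rightarrow> ('i \<Rightarrow> 'a \<Rightarrow> 'a \<Rightarrow> 'a) \<Rightarrow> ('i, 'k) npoly \<Rightarrow> bool" where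
  "satisfies scale mul f \<longleftrightarrow> (\<forall>x. eval_poly scale mul x f = 0)"

locale variety_algebra = omega_algebra scale I mul
  for scale :: "'k::field \<Rightarrow> 'a::ab_group_add \<Rightarrow> 'a" and I :: "'i set" and mul +
  fixes S :: "('i, 'k) npoly set"
  assumes identities: "f \<in> S \<Longrightarrow> satisfies scale mul f"

section \<open>Rota--Baxter operators\<close>

locale rota_baxter = omega_algebra scale I mul + Vector_Spaces.linear scale scale R
  for scale :: "'k::field \<Rightarrow> 'a::ab_group_add \<Rightarrow> 'a" and I :: "'i set" and mul
    and R :: "'a \<Rightarrow> 'a" +
  fixes weight :: 'k
  assumes rota_baxter: "i \<in> I \<Longrightarrow>
    mul i (R x) (R y) = R (mul i x (R y) + mul i (R x) y + scale weight (mul i x y))"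

section \<open>Skew tri-dendriform algebras\<close>

text \<open>
  An algebra with three operations per symbol of \<open>I\<close> is an algebra over the set of symbols
  \<open>I \<times> UNIV\<close>: the pairs \<open>(i, L)\<close>, \<open>(i, D)\<close>, \<open>(i, P)\<close> stand for
  \<open>\<turnstile>\<^sub>i\<close>, \<open>\<stileturn>\<^sub>i\<close>, \<open>\<bottom>\<^sub>i\<close>.
\<close>

datatype tri = L | D | P

fun star :: "'i monom \<Rightarrow> ('i \<times> tri, 'k::field) npoly" where
  "star (Var k) = Poly_Mapping.single (Var k) 1"
| "star (App i v w) = papp (i, L) (star v) (star w) + papp (i, D) (star v) (star w)"

text \<open>Only meaningful for poly-linear monomials and nonempty \<open>H \<subseteq> vars u\<close>.\<close>

fun Phi_monom :: "'i monom \<Rightarrow> nat set \<Rightarrow> ('i \<times> tri, 'k::field) npoly" where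
  "Phi_monom (Var k) H = Poly_Mapping.single (Var k) 1"
| "Phi_monom (App i v w) H =
     (if H \<inter> vars v \<noteq> {} \<and> H \<inter> vars w \<noteq> {}
        then papp (i, P) (Phi_monom v (H \<inter> vars v)) (Phi_monom w (H \<inter> vars w))
      else if H \<inter> vars v = {} then papp (i, L) (star v) (Phi_monom w H)
      else papp (i, D) (Phi_monom v H) (star w))"

definition Phi :: "('i, 'k::field) npoly \<Rightarrow> nat set \<Rightarrow> ('i \<times> tri, 'k) npoly" where
  "Phi f H = (\<Sum>u\<in>Poly_Mapping.keys f. cmul (Poly_Mapping.lookup f u) (Phi_monom u H))"

locale s_tri_dendriform = omega_algebra scale "I \<times> (UNIV :: tri set)" mul
  for scale :: "'k::field \<Rightarrow> 'a::ab_group_add \<Rightarrow> 'a" and I :: "'i set" and mul +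
  fixes S :: "('i, 'k) npoly set"
  assumes skew_left: "i \<in> I \<Longrightarrow> j \<in> I \<Longrightarrow> mul (j, L) (mul (i, P) x y) z = 0"
    and skew_right: "i \<in> I \<Longrightarrow> j \<in> I \<Longrightarrow> mul (i, D) x (mul (j, P) y z) = 0"
    and Phi_identities: "f \<in> S \<Longrightarrow> H \<noteq> {} \<Longrightarrow> H \<subseteq> {1..pdegree f} \<Longrightarrow> satisfies scale mul (Phi f H)"

end

theory Submission
  imports Defs
begin

text \<open>
  On \<open>A \<times> A\<close>, with the second factor playing the role of the image of the operator
  \<open>R (a, b) = (0, a)\<close>, the required identities leave only one choice for the product:
  \<open>(a, b) (c, d) = (b \<turnstile> c + a \<stileturn> d + a \<bottom> c, b \<turnstile> d + b \<stileturn> d)\<close>.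
  By multilinearity an identity \<open>f\<close> of \<open>Var\<close> need only be checked on arguments that lie in one of
  the two factors. If \<open>H\<close> is the set of indices of the arguments from the first factor, the value
  of \<open>f\<close> is that of \<open>\<Phi>\<^sup>\<star>(f\<^sup>H)\<close> when \<open>H \<noteq> \<emptyset>\<close>, and that of \<open>f\<^sup>\<star>\<close>, in the second factor, when
  \<open>H = \<emptyset>\<close>. Both vanish, because \<open>f\<^sup>\<star>\<close> is the sum of the \<open>\<Phi>\<^sup>\<star>(f\<^sup>{\<^sup>k\<^sup>})\<close> over all variables \<open>x\<^sub>k\<close>.
\<close>

section \<open>Evaluation of non-associative polynomials\<close>

context vector_space
begin

text \<open>Monomials outside the support have coefficient zero. Polynomials with different supports
  can thus be evaluated over one common finite set.\<close>

lemma eval_poly_superset: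
  assumes "finite A" "Poly_Mapping.keys p \<subseteq> A"
  shows "eval_poly scale mul x p = (\<Sum>u\<in>A. scale (Poly_Mapping.lookup p u) (eval_monom mul x u))"
  unfolding eval_poly_def
  by (rule sum.mono_neutral_left) (use assms in \<open>auto simp: in_keys_iff\<close>)

lemma eval_poly_zero [simp]: "eval_poly scale mul x 0 = 0"
  by (simp add: eval_poly_def)

lemma eval_poly_single [simp]:
  "eval_poly scale mul x (Poly_Mapping.single u c) = scale c (eval_monom mul x u)"
  by (simp add: eval_poly_def)

lemma eval_poly_add [simp]:
  "eval_poly scale mul x (p + q) = eval_poly scale mul x p + eval_poly scale mul x q"
proof -
  let ?A = "Poly_Mapping.keys p \<union> Poly_Mapping.keys q"
  have "Poly_Mapping.keys (p + q) \<subseteq> ?A"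
    by (rule Poly_Mapping.keys_add)
  then show ?thesis
    by (simp add: eval_poly_superset [of ?A] lookup_add scale_left_distrib sum.distrib)
qed

lemma eval_poly_sum:
  "eval_poly scale mul x (\<Sum>a\<in>A. p a) = (\<Sum>a\<in>A. eval_poly scale mul x (p a))"
  by (induction A rule: infinite_finite_induct) simp_all

lemma eval_poly_cmul: "eval_poly scale mul x (cmul c p) = scale c (eval_poly scale mul x p)"
proof -
  have lookup: "Poly_Mapping.lookup (cmul c p) u = c * Poly_Mapping.lookup p u" for u
    by (simp add: cmul_def map.rep_eq when_def)
  \<comment> \<open>Only an inclusion: for \<open>c = 0\<close> the support becomes empty.\<close>
  then have "Poly_Mapping.keys (cmul c p) \<subseteq> Poly_Mapping.keys p"
    by (auto simp: in_keys_iff)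
  then show ?thesis
    by (simp add: eval_poly_superset [of "Poly_Mapping.keys p"] lookup scale_sum_right)
qed

lemma eval_poly_Phi:
  "eval_poly scale mul x (Phi f H) =
    (\<Sum>u\<in>Poly_Mapping.keys f.
       scale (Poly_Mapping.lookup f u) (eval_poly scale mul x (Phi_monom u H)))"
  by (simp add: Phi_def eval_poly_sum eval_poly_cmul)

end

section \<open>Multilinear expansion of monomials\<close>

lemma eval_monom_cong:
  "(\<And>k. k \<in> vars u \<Longrightarrow> x k = y k) \<Longrightarrow> eval_monom mul x u = eval_monom mul y u"
  by (induction u) auto

text \<open>A subset \<open>H\<close> corresponds to the pair
  \<open>(H \<inter> V, H \<inter> W)\<close>. This splits a choice of variables along the two
  factors of a product.\<close>

lemma sum_Pow_Un_disjoint: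
  assumes "V \<inter> W = {}"
  shows "(\<Sum>H\<in>Pow (V \<union> W). g H) = (\<Sum>H1\<in>Pow V. \<Sum>H2\<in>Pow W. g (H1 \<union> H2))"
  unfolding sum.cartesian_product
  by (rule sum.reindex_bij_witness
      [where i = "\<lambda>(H1, H2). H1 \<union> H2" and j = "\<lambda>H. (H \<inter> V, H \<inter> W)"])
    (use assms in \<open>auto simp: Int_Un_distrib [symmetric] intro!: arg_cong [of _ _ g]\<close>)

context omega_algebra
begin

lemma
  assumes "i \<in> I"
  shows mul_add_left: "mul i (x + y) z = mul i x z + mul i y z"
    and mul_scale_left: "mul i (scale c x) z = scale c (mul i x z)"
    and mul_add_right: "mul i z (x + y) = mul i z x + mul i z y"
    and mul_scale_right: "mul i z (scale c x) = scale c (mul i z x)"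
    and mul_zero_left: "mul i 0 z = 0"
    and mul_zero_right: "mul i z 0 = 0"
    and mul_sum_left: "mul i (\<Sum>a\<in>A. g a) z = (\<Sum>a\<in>A. mul i (g a) z)"
    and mul_sum_right: "mul i z (\<Sum>a\<in>A. g a) = (\<Sum>a\<in>A. mul i z (g a))"
proof -
  interpret l: Vector_Spaces.linear scale scale "\<lambda>x. mul i x z"
    by (rule linear_left) fact
  interpret r: Vector_Spaces.linear scale scale "mul i z"
    by (rule linear_right) fact
  show "mul i (x + y) z = mul i x z + mul i y z" "mul i (scale c x) z = scale c (mul i x z)"
    "mul i z (x + y) = mul i z x + mul i z y" "mul i z (scale c x) = scale c (mul i z x)"
    "mul i 0 z = 0" "mul i z 0 = 0"
    "mul i (\<Sum>a\<in>A. g a) z = (\<Sum>a\<in>A. mul i (g a) z)"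
    "mul i z (\<Sum>a\<in>A. g a) = (\<Sum>a\<in>A. mul i z (g a))"
    by (rule l.add l.scale r.add r.scale l.zero r.zero l.sum r.sum)+
qed

lemma mul_sum_sum:
  assumes "i \<in> I"
  shows "mul i (\<Sum>a\<in>A. g a) (\<Sum>b\<in>B. h b) = (\<Sum>a\<in>A. \<Sum>b\<in>B. mul i (g a) (h b))"
  unfolding mul_sum_left [OF assms] by (simp add: mul_sum_right [OF assms])

lemma eval_poly_papp:
  assumes "i \<in> I"
  shows "eval_poly scale mul x (papp i p q) =
    mul i (eval_poly scale mul x p) (eval_poly scale mul x q)"
  unfolding papp_def eval_poly_sum eval_poly_single eval_poly_def [of _ _ _ p]
    eval_poly_def [of _ _ _ q]
  by (simp add: mul_sum_sum [OF assms] mul_scale_left [OF assms] mul_scale_right [OF assms]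
      mult.commute)

text \<open>Expanding a product picks \<open>p\<close> or \<open>q\<close> at every occurrence of a
  variable. As no variable repeats, the picks in the two factors are independent, and a set
  \<open>H\<close> of indices records them all.\<close>

lemma eval_monom_add:
  assumes "set_monom u \<subseteq> I" "distinct (var_list u)"
  shows "eval_monom mul (\<lambda>k. p k + q k) u =
    (\<Sum>H\<in>Pow (vars u). eval_monom mul (\<lambda>k. if k \<in> H then p k else q k) u)"
  using assms
proof (induction u)
  case (Var k)
  then show ?case
    by (simp add: Pow_insert add.commute)
next
  case (App i v w)
  let ?e = "\<lambda>H. eval_monom mul (\<lambda>k. if k \<in> H then p k else q k)"
  have i: "i \<in> I" and disj: "vars v \<inter> vars w = {}"
    using App.prems by auto
  have "mul i (?e H1 v) (?e H2 w) = ?e (H1 \<union> H2) (App i v w)"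
    if "H1 \<in> Pow (vars v)" "H2 \<in> Pow (vars w)" for H1 H2
  proof -
    \<comment> \<open>Adding \<open>H2\<close> to \<open>H1\<close> changes the assignment only at
      variables of \<open>w\<close>, and symmetrically.\<close>
    have "?e H1 v = ?e (H1 \<union> H2) v" "?e H2 w = ?e (H1 \<union> H2) w"
      using that disj by (auto intro!: eval_monom_cong)
    then show ?thesis
      by simp
  qed
  then have "(\<Sum>H\<in>Pow (vars (App i v w)). ?e H (App i v w)) =
    (\<Sum>H1\<in>Pow (vars v). \<Sum>H2\<in>Pow (vars w). mul i (?e H1 v) (?e H2 w))"
    using disj by (simp add: sum_Pow_Un_disjoint del: eval_monom.simps)
  then show ?case
    using App by (simp add: mul_sum_sum [OF i])
qed

end

section \<open>The value of \<open>f\<^sup>\<star>\<close>\<close>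

text \<open>A singleton \<open>{k}\<close> meets only one factor of a product, so
  \<open>Phi_monom\<close> yields \<open>(i, D)\<close> if \<open>k\<close> occurs on the left and
  \<open>(i, L)\<close> if it occurs on the right. Summing over \<open>k\<close> gives the two
  summands of \<open>star\<close>.\<close>

lemma eval_star_eq_sum_Phi:
  assumes "omega_algebra scale (I \<times> (UNIV :: tri set)) tmul"
    and "set_monom u \<subseteq> I" "distinct (var_list u)"
  shows "eval_poly scale tmul x (star u) =
    (\<Sum>k\<in>vars u. eval_poly scale tmul x (Phi_monom u {k}))"
proof -
  interpret omega_algebra scale "I \<times> (UNIV :: tri set)" tmul by fact
  show ?thesis
    using assms(2,3)
  proof (induction u)
    case (Var k)
    then show ?case by simp
  next
    case (App i v w)
    let ?e = "eval_poly scale tmul x"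
    have i: "(i, t) \<in> I \<times> UNIV" for t
      using App.prems by auto
    have disj: "vars v \<inter> vars w = {}"
      using App.prems by auto
    have "?e (Phi_monom (App i v w) {k}) = tmul (i, D) (?e (Phi_monom v {k})) (?e (star w))"
      if "k \<in> vars v" for k
      using that disj by (auto simp: eval_poly_papp [OF i])
    moreover have "?e (Phi_monom (App i v w) {k}) = tmul (i, L) (?e (star v)) (?e (Phi_monom w {k}))"
      if "k \<in> vars w" for k
      using that disj by (auto simp: eval_poly_papp [OF i])
    ultimately have "(\<Sum>k\<in>vars (App i v w). ?e (Phi_monom (App i v w) {k})) =
      tmul (i, D) (\<Sum>k\<in>vars v. ?e (Phi_monom v {k})) (?e (star w)) +
      tmul (i, L) (?e (star v)) (\<Sum>k\<in>vars w. ?e (Phi_monom w {k}))"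
      using disj by (simp add: sum.union_disjoint mul_sum_left [OF i] mul_sum_right [OF i]
          del: Phi_monom.simps)
    then show ?case
      using App by (simp add: eval_poly_papp [OF i] add.commute del: Phi_monom.simps)
  qed
qed

section \<open>The enveloping Rota--Baxter algebra\<close>

definition pair_scale :: "('k \<Rightarrow> 'a \<Rightarrow> 'a) \<Rightarrow> 'k \<Rightarrow> 'a \<times> 'a \<Rightarrow> 'a \<times> 'a" where
  "pair_scale scale c x = (scale c (fst x), scale c (snd x))"

text \<open>The first component has one summand for each case of \<open>Phi_monom\<close>; the
  second is the product that \<open>star\<close> uses.\<close>

definition pair_mul ::
  "('i \<times> tri \<Rightarrow> 'a \<Rightarrow> 'a \<Rightarrow> 'a::ab_group_add) \<Rightarrow> 'i \<Rightarrow> 'a \<times> 'a \<Rightarrow> 'a \<times> 'a \<Rightarrow> 'a \<times> 'a" where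
  "pair_mul tmul i x y =
    (tmul (i, L) (snd x) (fst y) + tmul (i, D) (fst x) (snd y) + tmul (i, P) (fst x) (fst y),
     tmul (i, L) (snd x) (snd y) + tmul (i, D) (snd x) (snd y))"

context
  fixes scale :: "'k::field \<Rightarrow> 'a::ab_group_add \<Rightarrow> 'a" and I :: "'i set"
    and tmul :: "'i \<times> tri \<Rightarrow> 'a \<Rightarrow> 'a \<Rightarrow> 'a"
  assumes tri: "omega_algebra scale (I \<times> (UNIV :: tri set)) tmul"
begin

interpretation omega_algebra scale "I \<times> (UNIV :: tri set)" tmul
  by (rule tri)

lemma vector_space_pair: "vector_space (pair_scale scale)"
  by unfold_locales
    (simp_all add: pair_scale_def scale_right_distrib scale_left_distrib)

lemma omega_algebra_pair: "omega_algebra (pair_scale scale) I (pair_mul tmul)"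
proof -
  interpret pair: vector_space "pair_scale scale" by (rule vector_space_pair)
  show ?thesis
  proof
    fix i x y z c
    assume i: "i \<in> I"
    then have t: "(i, t) \<in> I \<times> UNIV" for t :: tri by simp
    note bilinear = mul_add_left [OF t] mul_add_right [OF t] mul_scale_left [OF t]
      mul_scale_right [OF t]
    show "pair_mul tmul i (x + z) y = pair_mul tmul i x y + pair_mul tmul i z y"
      "pair_mul tmul i y (x + z) = pair_mul tmul i y x + pair_mul tmul i y z"
      "pair_mul tmul i (pair_scale scale c x) y = pair_scale scale c (pair_mul tmul i x y)"
      "pair_mul tmul i y (pair_scale scale c x) = pair_scale scale c (pair_mul tmul i y x)"
      by (simp_all add: pair_mul_def pair_scale_def bilinear scale_right_distrib)
  qed
qed

text \<open>Two elements that each lie in one factor have their product in the second factor if both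
  lie there, and in the first otherwise. The four combinations match the recursion for
  \<open>star\<close> and the three cases of \<open>Phi_monom\<close>.\<close>

lemma eval_monom_pair_mul:
  assumes "set_monom u \<subseteq> I"
  shows "eval_monom (pair_mul tmul) (\<lambda>k. if k \<in> H then (x k, 0) else (0, x k)) u =
    (if H \<inter> vars u = {} then (0, eval_poly scale tmul x (star u))
     else (eval_poly scale tmul x (Phi_monom u (H \<inter> vars u)), 0))"
  using assms
proof (induction u)
  case (Var k)
  then show ?case by auto
next
  case (App i v w)
  have t: "(i, t) \<in> I \<times> UNIV" for t :: tri
    using App.prems by simp
  \<comment> \<open>These turn the restrictions of \<open>H\<close> made by the recursion into those
    of the induction hypotheses.\<close>
  have "H \<inter> (vars v \<union> vars w) \<inter> vars v = H \<inter> vars v"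
    "H \<inter> (vars v \<union> vars w) \<inter> vars w = H \<inter> vars w"
    by auto
  moreover have "H \<inter> (vars v \<union> vars w) = H \<inter> vars w" if "H \<inter> vars v = {}"
    using that by auto
  moreover have "H \<inter> (vars v \<union> vars w) = H \<inter> vars v" if "H \<inter> vars w = {}"
    using that by auto
  ultimately show ?case
    using App
    by (auto simp: pair_mul_def eval_poly_papp [OF t] mul_zero_left [OF t] mul_zero_right [OF t])
qed

text \<open>The first components of \<open>x\<close> times \<open>R y\<close> and of
  \<open>R x\<close> times \<open>y\<close> are the \<open>(i, D)\<close> and \<open>(i, L)\<close>
  products of \<open>fst x\<close> and \<open>fst y\<close>. Their sum is the second component of
  \<open>R x\<close> times \<open>R y\<close>.\<close>

lemma rota_baxter_pair: "rota_baxter (pair_scale scale) I (pair_mul tmul) (\<lambda>x. (0, fst x)) 0"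
proof -
  interpret pair: omega_algebra "pair_scale scale" I "pair_mul tmul"
    by (rule omega_algebra_pair)
  show ?thesis
  proof
    fix i x y c
    show "(0 :: 'a, fst (x + y)) = (0, fst x) + (0, fst y)" for x y :: "'a \<times> 'a"
      by simp
    show "(0, fst (pair_scale scale c x)) = pair_scale scale c (0, fst x)"
      by (simp add: pair_scale_def)
    assume "i \<in> I"
    then have t: "(i, t) \<in> I \<times> UNIV" for t :: tri by simp
    show "pair_mul tmul i (0, fst x) (0, fst y) =
      (0, fst (pair_mul tmul i x (0, fst y) + pair_mul tmul i (0, fst x) y +
        pair_scale scale 0 (pair_mul tmul i x y)))"
      by (simp add: pair_mul_def pair_scale_def mul_zero_left [OF t] mul_zero_right [OF t]
          add.commute)
  qed
qed

end

section \<open>Identities of the variety on the pair algebra\<close>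

lemma pdegree_eqI:
  assumes "polylinear I n f" "f \<noteq> 0"
  shows "pdegree f = n"
proof -
  have "length (var_list u) = n" if "u \<in> Poly_Mapping.keys f" for u
    using assms(1) that distinct_card [of "var_list u"] by (auto simp: polylinear_def)
  moreover have "Poly_Mapping.keys f \<noteq> {}"
    using assms(2) by simp
  ultimately have "(\<lambda>u. length (var_list u)) ` Poly_Mapping.keys f = {n}"
    by (simp add: image_constant_conv cong: image_cong)
  then show ?thesis
    by (simp add: pdegree_def)
qed

lemma satisfies_pair:
  assumes "s_tri_dendriform scale I tmul S" "f \<in> S" "polylinear I n f"
  shows "satisfies (pair_scale scale) (pair_mul tmul) f"
\<comment> \<open>Only for \<open>f \<noteq> 0\<close> does \<open>n\<close> agree with
  \<open>pdegree f\<close>, which bounds \<open>H\<close> in \<open>Phi_identities\<close>.\<close>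
proof (cases "f = 0")
  case True
  then show ?thesis by (simp add: satisfies_def eval_poly_def)
next
  case False
  interpret s_tri_dendriform scale I tmul S by fact
  note tri = omega_algebra_axioms
  interpret pair: omega_algebra "pair_scale scale" I "pair_mul tmul"
    by (rule omega_algebra_pair [OF tri])
  let ?K = "Poly_Mapping.keys f" and ?c = "Poly_Mapping.lookup f"
  have keys: "set_monom u \<subseteq> I" "distinct (var_list u)" "vars u = {1..n}" if "u \<in> ?K" for u
    using assms(3) that by (auto simp: polylinear_def)
  have Phi_zero: "eval_poly scale tmul x (Phi f H) = 0" if "H \<noteq> {}" "H \<subseteq> {1..n}" for H x
    using Phi_identities [OF assms(2)] that
    by (simp add: satisfies_def pdegree_eqI [OF assms(3) False])
  \<comment> \<open>Every monomial has the same variables, so the sums over \<open>u\<close> and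
    \<open>k\<close> can be exchanged, leaving the identities for singletons.\<close>
  have star_zero: "(\<Sum>u\<in>?K. scale (?c u) (eval_poly scale tmul x (star u))) = 0" for x
  proof -
    have "(\<Sum>u\<in>?K. scale (?c u) (eval_poly scale tmul x (star u))) =
      (\<Sum>u\<in>?K. \<Sum>k\<in>{1..n}. scale (?c u) (eval_poly scale tmul x (Phi_monom u {k})))"
      using keys by (simp add: eval_star_eq_sum_Phi [OF tri] scale_sum_right)
    also have "\<dots> = (\<Sum>k\<in>{1..n}. eval_poly scale tmul x (Phi f {k}))"
      by (subst sum.swap) (simp add: eval_poly_Phi)
    finally show ?thesis
      by (simp add: Phi_zero)
  qed
  have homogeneous:
    "(\<Sum>u\<in>?K. pair_scale scale (?c u)
      (eval_monom (pair_mul tmul) (\<lambda>k. if k \<in> H then (x k, 0) else (0, x k)) u)) = 0"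
    if "H \<subseteq> {1..n}" for H x
  proof (cases "H = {}")
    case True
    then show ?thesis
      using keys star_zero [of x]
      by (simp add: eval_monom_pair_mul [OF tri, of _ "{}", simplified] pair_scale_def
          prod_eq_iff fst_sum snd_sum)
  next
    case False
    \<comment> \<open>Restricting \<open>H\<close> to any monomial gives back \<open>H\<close>, so
      the values add up to that of \<open>Phi f H\<close>.\<close>
    then have "H \<inter> {1..n} = H" using that by auto
    then show ?thesis
      using keys False Phi_zero [OF False that, of x]
      by (simp add: eval_monom_pair_mul [OF tri] pair_scale_def prod_eq_iff fst_sum snd_sum
          eval_poly_Phi)
  qed
  show ?thesis
    unfolding satisfies_def
  proof
    fix x :: "nat \<Rightarrow> 'b \<times> 'b"
    let ?y = "\<lambda>H k. if k \<in> H then (fst (x k), 0) else (0, snd (x k))"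
    have "eval_monom (pair_mul tmul) x u =
      (\<Sum>H\<in>Pow {1..n}. eval_monom (pair_mul tmul) (?y H) u)" if "u \<in> ?K" for u
      using pair.eval_monom_add [of u "\<lambda>k. (fst (x k), 0)" "\<lambda>k. (0, snd (x k))"] keys [OF that]
      by simp
    then have "eval_poly (pair_scale scale) (pair_mul tmul) x f =
      (\<Sum>u\<in>?K. \<Sum>H\<in>Pow {1..n}. pair_scale scale (?c u) (eval_monom (pair_mul tmul) (?y H) u))"
      by (simp add: eval_poly_def pair.scale_sum_right)
    also have "\<dots> = (\<Sum>H\<in>Pow {1..n}. \<Sum>u\<in>?K.
      pair_scale scale (?c u) (eval_monom (pair_mul tmul) (?y H) u))"
      by (rule sum.swap)
    also have "\<dots> = 0"
    proof (rule sum.neutral, rule ballI)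
      fix H assume "H \<in> Pow {1..n}"
      \<comment> \<open>\<open>homogeneous\<close> takes a single assignment for both factors; the
        components selected by \<open>H\<close> are merged into one.\<close>
      moreover have "?y H = (\<lambda>k. if k \<in> H then (if k \<in> H then fst (x k) else snd (x k), 0)
          else (0, if k \<in> H then fst (x k) else snd (x k)))"
        by auto
      ultimately show "(\<Sum>u\<in>?K. pair_scale scale (?c u) (eval_monom (pair_mul tmul) (?y H) u)) = 0"
        using homogeneous [of H "\<lambda>k. if k \<in> H then fst (x k) else snd (x k)"] by simp
    qed
    finally show "eval_poly (pair_scale scale) (pair_mul tmul) x f = 0" .
  qed
qed

theorem theorem3:
  fixes scale :: "'k::field \<Rightarrow> 'a::ab_group_add \<Rightarrow> 'a"
    and I :: "'i set"
    and S :: "('i, 'k) npoly set"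
    and tmul :: "'i \<times> tri \<Rightarrow> 'a \<Rightarrow> 'a \<Rightarrow> 'a"
  assumes "\<forall>f\<in>S. \<exists>n>1. polylinear I n f"
    and "s_tri_dendriform scale I tmul S"
  shows "\<exists>(scale' :: 'k \<Rightarrow> 'a \<times> 'a \<Rightarrow> 'a \<times> 'a) (mul :: 'i \<Rightarrow> 'a \<times> 'a \<Rightarrow> 'a \<times> 'a \<Rightarrow> 'a \<times> 'a)
      (R :: 'a \<times> 'a \<Rightarrow> 'a \<times> 'a) (\<iota> :: 'a \<Rightarrow> 'a \<times> 'a).
    variety_algebra scale' I mul S \<and>
    rota_baxter scale' I mul R 0 \<and>
    Vector_Spaces.linear scale scale' \<iota> \<and> inj \<iota> \<and>
    (\<forall>i\<in>I. \<forall>a b.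
      \<iota> (tmul (i, L) a b) = mul i (R (\<iota> a)) (\<iota> b) \<and>
      \<iota> (tmul (i, D) a b) = mul i (\<iota> a) (R (\<iota> b)) \<and>
      \<iota> (tmul (i, P) a b) = mul i (\<iota> a) (\<iota> b))"
proof -
  interpret s_tri_dendriform scale I tmul S by fact
  note tri = omega_algebra_axioms
  interpret pair: omega_algebra "pair_scale scale" I "pair_mul tmul"
    by (rule omega_algebra_pair [OF tri])
  have "variety_algebra (pair_scale scale) I (pair_mul tmul) S"
    by unfold_locales (use assms satisfies_pair in blast)
  moreover have "Vector_Spaces.linear scale (pair_scale scale) (\<lambda>a. (a, 0))"
    by unfold_locales (simp_all add: pair_scale_def)
  moreover have "inj (\<lambda>a::'a. (a, 0::'a))"
    by (simp add: inj_def)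
  \<comment> \<open>Here \<open>R (\<iota> a) = (0, a)\<close>. The zero components leave one
    summand of the first component and annihilate the second.\<close>
  moreover have "(tmul (i, L) a b, 0) = pair_mul tmul i (0, fst (a, 0)) (b, 0) \<and>
      (tmul (i, D) a b, 0) = pair_mul tmul i (a, 0) (0, fst (b, 0)) \<and>
      (tmul (i, P) a b, 0) = pair_mul tmul i (a, 0) (b, 0)" if "i \<in> I" for i a b
    using that by (simp add: pair_mul_def mul_zero_left mul_zero_right)
  ultimately show ?thesis
    using rota_baxter_pair [OF tri] by blast
qed

end
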